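(* Let $(A,\prec_\lambda,\succ_\lambda)$ be a dendriform conformal algebra. Then $(A,L_\succ,R_\prec)$ is a bimodule of the associated associative conformal algebra $(A,\ast_\lambda)$. Hence the identity $I$ is an $\mathcal{O}$-operator of the associative conformal algebra $(A,\ast_\lambda)$ associated with $(A,L_\succ,R_\prec)$.
   Context: Everything is over $\mathbb{C}$. A dendriform conformal algebra is a $\mathbb{C}[\partial]$-module $A$ with two $\mathbb{C}$-bilinear products $\prec_\lambda,\succ_\lambda:A\times A\to A[\lambda]$ such that for all $a,b,c\in A$, with $a\ast_\lambda b=a\prec_\lambda b+a\succ_\lambda b$: $(\partial a)\succ_\lambda b=-\lambda\, a\succ_\lambda b$, $a\succ_\lambda(\partial b)=(\partial+\lambda)(a\succ_\lambda b)$, $(\partial a)\prec_\lambda b=-\lambda\, a\prec_\lambda b$, $a\prec_\lambda(\partial b)=(\partial+\lambda)(a\prec_\lambda b)$, $(a\prec_\lambda b)\prec_{\lambda+\mu}c=a\prec_\lambda(b\ast_\mu c)$, $(a\succ_\lambda b)\prec_{\lambda+\mu}c=a\succ_\lambda(b\prec_\mu c)$, $a\succ_\lambda(b\succ_\mu c)=(a\ast_\lambda b)\succ_{\lambda+\mu}c$. The associated associative conformal algebra is $(A,\ast_\lambda)$ (an associative conformal algebra: $\mathbb{C}[\partial]$-module with bilinear $\lambda$-product satisfying $(\partial a)_\lambda b=-\lambda a_\lambda b$, $a_\lambda(\partial b)=(\partial+\lambda)(a_\lambda b)$, $(a_\lambda b)_{\lambda+\mu}c=a_\lambda(b_\mu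 c)$). Convention: a subscript $-\lambda-\partial$ on an operation means: expand in powers of the subscript variable $\nu$ and replace $\nu^k$ by $(-\lambda-\partial)^k$, $\partial$ acting on the coefficients. Set $L_\succ(a)_\lambda b=a\succ_\lambda b$ and $R_\prec(a)_\lambda b=b\prec_{-\lambda-\partial}a$. $Cend(M)$: $\mathbb{C}$-linear maps $\phi_\lambda:M\to M[\lambda]$ with $\phi_\lambda(\partial v)=(\partial+\lambda)\phi_\lambda v$, a $\mathbb{C}[\partial]$-module via $(\partial\phi)_\lambda=-\lambda\phi_\lambda$. A bimodule $(M,l_A,r_A)$ of an associative conformal algebra $A$ (product $a_\lambda b$) is a $\mathbb{C}[\partial]$-module $M$ with $\mathbb{C}[\partial]$-module homomorphisms $l_A,r_A:A\to Cend(M)$ such that $l_A(a_\lambda b)_{\lambda+\mu}v=l_A(a)_\lambda(l_A(b)_\mu v)$, $r_A(b)_{-\lambda-\mu-\partial}(r_A(a)_{-\lambda-\partial}v)=r_A(a_\mu b)_{-\lambda-\partial}v$, $l_A(a)_\lambda(r_A(b)_{-\mu-\partial}v)=r_A(b)_{-\lambda-\mu-\partial}(l_A(a)_\lambda v)$. An $\mathcal{O}$-operator of $A$ associated with $(M,l_A,r_A)$ is a $\mathbb{C}[\partial]$-module homomorphism $T:M\to A$ with $T(u)_\lambda T(v)=T(l_A(T(u))_\lambda v)+T(r_A(T(v))_{-\lambda-\partial}u)$ for all $u,v\in M$. *)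

theory Defs
  imports
    Complex_Main
    "HOL-Computational_Algebra.Polynomial"
    "HOL-Library.Function_Algebras"
begin

text \<open>
  A \<open>\<complex>[\<partial>]\<close>-module is a module over the ring \<^typ>\<open>complex poly\<close> in the sense of
  \<^locale>\<open>module\<close>, the indeterminate being \<open>\<partial>\<close>.  For a module \<open>A\<close> of type \<open>'a\<close>,
  the polynomials \<open>A[\<lambda>]\<close> are \<open>'a poly\<close>, and \<open>A[\<lambda>,\<mu>]\<close> is
  \<open>'a poly poly\<close>, with \<open>\<lambda>\<close> the outer and \<open>\<mu>\<close> the inner variable.
\<close>

definition cscale :: "(complex poly \<Rightarrow> 'a \<Rightarrow> 'a) \<Rightarrow> complex \<Rightarrow> 'a \<Rightarrow> 'a" where
  "cscale s c x = s [:c:] x"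

definition pscale :: "(complex poly \<Rightarrow> 'a \<Rightarrow> 'a) \<Rightarrow> complex \<Rightarrow> 'a::zero poly \<Rightarrow> 'a poly" where
  "pscale s c = map_poly (cscale s c)"


subsection \<open>Formal variables and substitution\<close>

text \<open>
  For \<open>p = (\<Sum>k. \<nu>\<^sup>k x\<^sub>k)\<close> this is \<open>\<Sum>k. F\<^sup>k (g x\<^sub>k)\<close>:
  the additive map \<open>g\<close> is applied to the coefficients, and the variable \<open>\<nu>\<close> is
  replaced by the operator \<open>F\<close>.
\<close>

definition poly_subst :: "('b \<Rightarrow> 'b) \<Rightarrow> ('a::zero \<Rightarrow> 'b) \<Rightarrow> 'a poly \<Rightarrow> 'b::comm_monoid_add" where
  "poly_subst F g p = (\<Sum>k\<le>degree p. (F ^^ k) (g (coeff p k)))"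

text \<open>The operators \<open>\<lambda>\<close> and \<open>\<partial>\<close> on \<open>A[\<lambda>]\<close>.  Sums and differences of operators
  are pointwise.\<close>

definition lam1 :: "'a::zero poly \<Rightarrow> 'a poly" where
  "lam1 = pCons 0"

definition del1 :: "(complex poly \<Rightarrow> 'a \<Rightarrow> 'a) \<Rightarrow> 'a::zero poly \<Rightarrow> 'a poly" where
  "del1 s = map_poly (s [:0, 1:])"

text \<open>The operators \<open>\<lambda>\<close>, \<open>\<mu>\<close> and \<open>\<partial>\<close> on \<open>A[\<lambda>,\<mu>]\<close>.\<close>

definition lam2 :: "'a::zero poly poly \<Rightarrow> 'a poly poly" where
  "lam2 = pCons 0"

definition mu2 :: "'a::zero poly poly \<Rightarrow> 'a poly poly" where
  "mu2 = map_poly (pCons 0)"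

definition del2 :: "(complex poly \<Rightarrow> 'a \<Rightarrow> 'a) \<Rightarrow> 'a::zero poly poly \<Rightarrow> 'a poly poly" where
  "del2 s = map_poly (map_poly (s [:0, 1:]))"

text \<open>\<open>at1 F\<close> and \<open>at2 F\<close> replace the variable of a polynomial in \<open>A[\<nu>]\<close> by an
  operator \<open>F\<close> on \<open>A[\<lambda>]\<close>, respectively on \<open>A[\<lambda>,\<mu>]\<close>.\<close>

definition at1 :: "('a poly \<Rightarrow> 'a poly) \<Rightarrow> 'a::comm_monoid_add poly \<Rightarrow> 'a poly" where
  "at1 F = poly_subst F (\<lambda>x. [:x:])"

definition at2 :: "('a poly poly \<Rightarrow> 'a poly poly) \<Rightarrow> 'a::comm_monoid_add poly \<Rightarrow> 'a poly poly" where
  "at2 F = poly_subst F (\<lambda>x. [:[:x:]:])"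


subsection \<open>Associative and dendriform conformal algebras\<close>

locale conformal_product = module scale
  for scale :: "complex poly \<Rightarrow> 'a::ab_group_add \<Rightarrow> 'a" +
  fixes prd :: "'a \<Rightarrow> 'a \<Rightarrow> 'a poly"
  assumes linear_left: "Vector_Spaces.linear (cscale scale) (pscale scale) (\<lambda>a. prd a b)"
    and linear_right: "Vector_Spaces.linear (cscale scale) (pscale scale) (prd a)"
    and del_left: "prd (scale [:0, 1:] a) b = (- lam1) (prd a b)"
    and del_right: "prd a (scale [:0, 1:] b) = (del1 scale + lam1) (prd a b)"

locale assoc_conformal_algebra = conformal_product scale prd
  for scale :: "complex poly \<Rightarrow> 'a::ab_group_add \<Rightarrow> 'a"
    and prd :: "'a \<Rightarrow> 'a \<Rightarrow> 'a poly" +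
  assumes assoc:
    "poly_subst lam2 (\<lambda>x. at2 (lam2 + mu2) (prd x c)) (prd a b) =
     poly_subst mu2 (\<lambda>y. at2 lam2 (prd a y)) (prd b c)"

definition star_product ::
    "('a \<Rightarrow> 'a \<Rightarrow> 'a poly) \<Rightarrow> ('a \<Rightarrow> 'a \<Rightarrow> 'a poly) \<Rightarrow> 'a \<Rightarrow> 'a \<Rightarrow> 'a::comm_monoid_add poly" where
  "star_product lprd rprd a b = lprd a b + rprd a b"

text \<open>\<open>lprd\<close> is \<open>\<prec>\<^sub>\<lambda>\<close> and \<open>rprd\<close> is \<open>\<succ>\<^sub>\<lambda>\<close>.\<close>

locale dendriform_conformal_algebra =
  lprd: conformal_product scale lprd + rprd: conformal_product scale rprd
  for scale :: "complex poly \<Rightarrow> 'a::ab_group_add \<Rightarrow> 'a"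
    and lprd rprd :: "'a \<Rightarrow> 'a \<Rightarrow> 'a poly" +
  assumes prec_prec:
    "poly_subst lam2 (\<lambda>x. at2 (lam2 + mu2) (lprd x c)) (lprd a b) =
     poly_subst mu2 (\<lambda>y. at2 lam2 (lprd a y)) (star_product lprd rprd b c)"
    and succ_prec:
    "poly_subst lam2 (\<lambda>x. at2 (lam2 + mu2) (lprd x c)) (rprd a b) =
     poly_subst mu2 (\<lambda>y. at2 lam2 (rprd a y)) (lprd b c)"
    and succ_succ:
    "poly_subst mu2 (\<lambda>y. at2 lam2 (rprd a y)) (rprd b c) =
     poly_subst lam2 (\<lambda>x. at2 (lam2 + mu2) (rprd x c)) (star_product lprd rprd a b)"

definition L_succ :: "('a \<Rightarrow> 'a \<Rightarrow> 'a poly) \<Rightarrow> 'a \<Rightarrow> 'a \<Rightarrow> 'a::zero poly" where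
  "L_succ rprd a b = rprd a b"

definition R_prec ::
    "(complex poly \<Rightarrow> 'a \<Rightarrow> 'a) \<Rightarrow> ('a \<Rightarrow> 'a \<Rightarrow> 'a poly) \<Rightarrow> 'a \<Rightarrow> 'a \<Rightarrow> 'a::ab_group_add poly" where
  "R_prec scale lprd a b = at1 (- lam1 - del1 scale) (lprd b a)"


subsection \<open>Bimodules\<close>

definition Cend ::
    "(complex poly \<Rightarrow> 'm::ab_group_add \<Rightarrow> 'm) \<Rightarrow> ('m \<Rightarrow> 'm poly) set" where
  "Cend s = {\<phi>. Vector_Spaces.linear (cscale s) (pscale s) \<phi> \<and>
                 (\<forall>v. \<phi> (s [:0, 1:] v) = (del1 s + lam1) (\<phi> v))}"

text \<open>
  The \<open>\<complex>[\<partial>]\<close>-module structure determined by \<open>(\<partial>\<phi>)\<^sub>\<lambda> = -\<lambda> \<phi>\<^sub>\<lambda>\<close>, that is,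
  \<open>(p(\<partial>)\<phi>)\<^sub>\<lambda> = p(-\<lambda>) \<phi>\<^sub>\<lambda>\<close>.  The formula makes sense for all maps
  \<open>M \<rightarrow> M[\<lambda>]\<close> and restricts to \<open>Cend(M)\<close>.
\<close>

definition cend_scale ::
    "(complex poly \<Rightarrow> 'm::ab_group_add \<Rightarrow> 'm) \<Rightarrow> complex poly \<Rightarrow> ('m \<Rightarrow> 'm poly) \<Rightarrow> 'm \<Rightarrow> 'm poly" where
  "cend_scale s p \<phi> v = poly_subst (- lam1) (\<lambda>c. pscale s c (\<phi> v)) p"

lemma cend_scale_del:
  assumes "module s"
  shows "cend_scale s [:0, 1:] \<phi> = (- lam1) \<circ> \<phi>"
proof -
  interpret module s by fact
  have "pscale s 0 q = 0" "pscale s 1 q = q" for q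
    by (simp_all add: poly_eq_iff pscale_def coeff_map_poly cscale_def flip: one_pCons)
  then show ?thesis
    by (simp add: fun_eq_iff cend_scale_def poly_subst_def eval_nat_numeral lam1_def)
qed

lemma cend_scale_const:
  "cend_scale s [:c:] \<phi> = pscale s c \<circ> \<phi>"
  by (simp add: fun_eq_iff cend_scale_def poly_subst_def)

lemma module_cend_scale:
  fixes s :: "complex poly \<Rightarrow> 'b::ab_group_add \<Rightarrow> 'b"
  assumes "module s" shows "module (cend_scale s)"
proof -
  interpret module s by fact
  have ps0: "pscale s 0 q = 0" for q by (simp add: poly_eq_iff pscale_def coeff_map_poly cscale_def)
  have psc: "coeff (pscale s c q) i = s [:c:] (coeff q i)" for c q i
    by (simp add: pscale_def coeff_map_poly cscale_def)
  have ps_add: "pscale s c (p + q) = pscale s c p + pscale s c q" for c p q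
    by (simp add: poly_eq_iff psc scale_right_distrib)
  have ps_addl: "pscale s (c + d) q = pscale s c q + pscale s d q" for c d q
    by (simp add: poly_eq_iff psc scale_left_distrib flip: add_pCons)
       (metis add_pCons add_0 scale_left_distrib)
  have ps_mult: "pscale s c (pscale s d q) = pscale s (c * d) q" for c d q
    by (simp add: poly_eq_iff psc mult.commute)
  have pl: "pscale s c (((- lam1) ^^ k) q) = ((- lam1) ^^ k) (pscale s c q)" for c k and q :: "'b poly"
    by (induction k) (auto simp: poly_eq_iff psc lam1_def coeff_pCons split: nat.splits)
  have ladd: "((- lam1) ^^ k) (p + q) = ((- lam1) ^^ k) p + ((- lam1) ^^ k) q" for k and p q :: "'b poly"
    by (induction k) (auto simp: lam1_def)
  have l0: "((- lam1) ^^ k) 0 = (0 :: 'b poly)" for k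
    by (induction k) (auto simp: lam1_def)
  have P0: "cend_scale s 0 \<phi> = 0" for \<phi> :: "'b \<Rightarrow> 'b poly"
    by (simp add: fun_eq_iff cend_scale_def poly_subst_def ps0)
  have PC: "cend_scale s (pCons c p) \<phi> v = pscale s c (\<phi> v) + (- lam1) (cend_scale s p \<phi> v)"
    for c p v and \<phi> :: "'b \<Rightarrow> 'b poly"
  proof (cases "p = 0")
    case True then show ?thesis by (simp add: P0 cend_scale_def poly_subst_def ps0 lam1_def)
  next
    case False
    have "(- lam1) (\<Sum>k\<le>n. f k) = (\<Sum>k\<le>n. (- lam1) (f k))" for n and f :: "nat \<Rightarrow> 'b poly"
      using ladd[of 1] by (induction n) auto
    with False show ?thesis
      by (simp add: cend_scale_def poly_subst_def sum.atMost_Suc_shift del: sum.atMost_Suc)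
  qed
  have l1: "(- lam1) (p + q) = (- lam1) p + (- lam1) q" for p q :: "'b poly" using ladd[of 1] by simp
  have p1: "pscale s c ((- lam1) q) = (- lam1) (pscale s c q)" for c and q :: "'b poly" using pl[of c 1] by simp
  note [simp del] = fun_Compl_def uminus_apply
  have A: "cend_scale s (p + q) \<phi> v = cend_scale s p \<phi> v + cend_scale s q \<phi> v" for p q v and \<phi> :: "'b \<Rightarrow> 'b poly"
    by (induction p q rule: poly_induct2) (auto simp: P0 PC ps_addl l1 algebra_simps)
  have B: "cend_scale s p (\<phi> + \<psi>) v = cend_scale s p \<phi> v + cend_scale s p \<psi> v" for p v and \<phi> \<psi> :: "'b \<Rightarrow> 'b poly"
    by (induction p) (auto simp: P0 PC ps_add l1 algebra_simps)
  have C: "cend_scale s (smult c q) \<phi> v = pscale s c (cend_scale s q \<phi> v)" for c q v and \<phi> :: "'b \<Rightarrow> 'b poly"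
    by (induction q) (auto simp: P0 PC ps_add ps_mult p1, simp add: pscale_def)
  have D: "cend_scale s p (cend_scale s q \<phi>) v = cend_scale s (p * q) \<phi> v" for p q v and \<phi> :: "'b \<Rightarrow> 'b poly"
    by (induction p) (auto simp: P0 PC A C ps0)
  show ?thesis
  proof
    show "cend_scale s 1 \<phi> = \<phi>" for \<phi> :: "'b \<Rightarrow> 'b poly"
      using cend_scale_const[of s 1 \<phi>] by (simp add: fun_eq_iff poly_eq_iff psc flip: one_pCons)
  qed (auto simp: A B D fun_eq_iff)
qed
locale conformal_bimodule =
  alg: assoc_conformal_algebra scaleA prd + M: module scaleM +
  l: module_hom scaleA "cend_scale scaleM" l + r: module_hom scaleA "cend_scale scaleM" r
  for scaleA :: "complex poly \<Rightarrow> 'a::ab_group_add \<Rightarrow> 'a"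
    and prd :: "'a \<Rightarrow> 'a \<Rightarrow> 'a poly"
    and scaleM :: "complex poly \<Rightarrow> 'm::ab_group_add \<Rightarrow> 'm"
    and l r :: "'a \<Rightarrow> 'm \<Rightarrow> 'm poly" +
  assumes l_Cend: "l a \<in> Cend scaleM"
    and r_Cend: "r a \<in> Cend scaleM"
    and l_prd:
    "poly_subst lam2 (\<lambda>x. at2 (lam2 + mu2) (l x v)) (prd a b) =
     poly_subst mu2 (\<lambda>w. at2 lam2 (l a w)) (l b v)"
    and r_prd:
    "poly_subst lam2 (\<lambda>w. at2 (- lam2 - mu2 - del2 scaleM) (r b w))
       (at1 (- lam1 - del1 scaleM) (r a v)) =
     poly_subst mu2 (\<lambda>x. at2 (- lam2 - del2 scaleM) (r x v)) (prd a b)"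
    and l_r:
    "poly_subst mu2 (\<lambda>w. at2 lam2 (l a w)) (at1 (- lam1 - del1 scaleM) (r b v)) =
     poly_subst lam2 (\<lambda>w. at2 (- lam2 - mu2 - del2 scaleM) (r b w)) (l a v)"


subsection \<open>O-operators\<close>

locale O_operator =
  conformal_bimodule scaleA prd scaleM l r + T: module_hom scaleM scaleA T
  for scaleA :: "complex poly \<Rightarrow> 'a::ab_group_add \<Rightarrow> 'a"
    and prd :: "'a \<Rightarrow> 'a \<Rightarrow> 'a poly"
    and scaleM :: "complex poly \<Rightarrow> 'm::ab_group_add \<Rightarrow> 'm"
    and l r :: "'a \<Rightarrow> 'm \<Rightarrow> 'm poly"
    and T :: "'m \<Rightarrow> 'a" +
  assumes O_identity:
    "prd (T u) (T v) =
     map_poly T (l (T u) v) + map_poly T (at1 (- lam1 - del1 scaleM) (r (T v) u))"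

end

theory Submission
  imports Defs
begin

text \<open>
  Write \<open>K = -\<lambda> - \<partial>\<close>.  Replacing \<open>\<nu>\<close> by \<open>K\<close> and then \<open>\<lambda>\<close> by any operator \<open>G\<close>
  commuting with \<open>\<partial>\<close> amounts to replacing \<open>\<nu>\<close> by \<open>-G - \<partial>\<close>.  With \<open>G = K\<close> this
  says that \<open>K\<close> is an involution, so that \<open>R\<^sub>\<prec>(a)\<^bsub>-\<lambda>-\<partial>\<^esub> b = b \<prec>\<^sub>\<lambda> a\<close>, and with
  \<open>G = -\<lambda>-\<mu>-\<partial>\<close> that \<open>R\<^sub>\<prec>(a)\<^bsub>-\<lambda>-\<mu>-\<partial>\<^esub> b = b \<prec>\<^bsub>\<lambda>+\<mu>\<^esub> a\<close>.  After these
  substitutions the three bimodule axioms are the three dendriform axioms, their sum is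
  associativity of \<open>\<ast>\<^sub>\<lambda>\<close>, and the identity of an \<open>\<O>\<close>-operator is the definition of \<open>\<ast>\<^sub>\<lambda>\<close>.
\<close>

section \<open>Additivity of the operators that get substituted\<close>

lemma additive_plus: "additive F \<Longrightarrow> additive G \<Longrightarrow> additive (F + G)"
  for F G :: "'a::ab_group_add \<Rightarrow> 'b::ab_group_add"
  by (simp add: additive_def algebra_simps)

lemma additive_uminus: "additive F \<Longrightarrow> additive (- F)"
  for F :: "'a::ab_group_add \<Rightarrow> 'b::ab_group_add"
  by (simp add: additive_def)

lemma additive_minus: "additive F \<Longrightarrow> additive G \<Longrightarrow> additive (F - G)"
  for F G :: "'a::ab_group_add \<Rightarrow> 'b::ab_group_add"
  by (simp add: additive_def algebra_simps)

lemma additive_map_poly: "additive h \<Longrightarrow> additive (map_poly h)"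
  for h :: "'a::ab_group_add \<Rightarrow> 'b::ab_group_add"
  by (simp add: additive_def poly_eq_iff coeff_map_poly additive.zero[unfolded additive_def])

lemma additive_pCons_0: "additive (pCons (0 :: 'a::ab_group_add))"
  by (simp add: additive_def)

lemma additive_const_poly: "additive (\<lambda>x :: 'a::ab_group_add. [:x:])"
  by (simp add: additive_def)

lemma additive_const_poly2: "additive (\<lambda>x :: 'a::ab_group_add. [:[:x:]:])"
  by (simp add: additive_def)

lemma additive_lam1: "additive (lam1 :: 'a::ab_group_add poly \<Rightarrow> _)"
  unfolding lam1_def by (rule additive_pCons_0)

lemma additive_lam2: "additive (lam2 :: 'a::ab_group_add poly poly \<Rightarrow> _)"
  unfolding lam2_def by (rule additive_pCons_0)

lemma additive_mu2: "additive (mu2 :: 'a::ab_group_add poly poly \<Rightarrow> _)"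
  unfolding mu2_def by (intro additive_map_poly additive_pCons_0)

lemmas additive_operators = additive_plus additive_uminus additive_minus
  additive_const_poly additive_const_poly2 additive_lam1 additive_lam2 additive_mu2


subsection \<open>Substitution of operators\<close>

text \<open>As \<open>degree 0 = 0\<close>, the sum keeps its term \<open>k = 0\<close>; the value
  is therefore \<open>g 0\<close>, which vanishes once \<open>g\<close> is additive.\<close>

lemma poly_subst_0 [simp]: "poly_subst F g 0 = g 0"
  by (simp add: poly_subst_def)

lemma poly_subst_const [simp]: "poly_subst F g [:a:] = g a"
  by (simp add: poly_subst_def)

text \<open>Horner's rule: it trades the sum up to the degree for a recursion that fits induction
  over \<open>pCons\<close>. Additivity also covers \<open>p = 0\<close>, where
  \<open>F (g 0)\<close> has to vanish.\<close>

lemma poly_subst_pCons: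
  fixes F :: "'b::ab_group_add \<Rightarrow> 'b" and g :: "'a::ab_group_add \<Rightarrow> 'b"
  assumes "additive F" "additive g"
  shows "poly_subst F g (pCons a p) = g a + F (poly_subst F g p)"
proof (cases "p = 0")
  case True
  then show ?thesis using assms by (simp add: additive.zero)
next
  case False
  then show ?thesis
    by (simp add: poly_subst_def sum.atMost_Suc_shift additive.sum[OF assms(1)] del: sum.atMost_Suc)
qed

lemma additive_poly_subst:
  fixes F :: "'b::ab_group_add \<Rightarrow> 'b" and g :: "'a::ab_group_add \<Rightarrow> 'b"
  assumes "additive F" "additive g"
  shows "additive (poly_subst F g)"
proof
  show "poly_subst F g (p + q) = poly_subst F g p + poly_subst F g q" for p q
    by (induction p q rule: poly_induct2)
      (simp_all add: poly_subst_pCons assms additive.add[OF assms(1)] additive.add[OF assms(2)]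
        additive.zero[OF assms(2)])
qed

text \<open>Serves the outer product in the associativity law, where the sum sits in the coefficient
  map and not in the polynomial.\<close>

lemma poly_subst_fun_plus:
  fixes F :: "'b::ab_group_add \<Rightarrow> 'b" and g h :: "'a::ab_group_add \<Rightarrow> 'b"
  assumes "additive F" "additive g" "additive h"
  shows "poly_subst F (\<lambda>x. g x + h x) p = poly_subst F g p + poly_subst F h p"
proof -
  have "additive (\<lambda>x. g x + h x)"
    using additive_plus[OF assms(2,3)] by (simp add: plus_fun_def)
  then show ?thesis
    by (induction p)
      (simp_all add: poly_subst_pCons assms additive.add[OF assms(1)])
qed

lemma poly_subst_map_poly:
  fixes F :: "'b::ab_group_add \<Rightarrow> 'b" and g :: "'a::ab_group_add \<Rightarrow> 'b"
  assumes "additive F" "additive g" "additive D" "additive h"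
    and "\<And>x. D (F x) = F (D x)" "\<And>x. g (h x) = D (g x)"
  shows "poly_subst F g (map_poly h p) = D (poly_subst F g p)"
proof (induction p)
  case 0
  then show ?case by (simp add: additive.zero assms)
next
  case (pCons a p)
  then show ?case
    by (simp add: map_poly_pCons additive.zero poly_subst_pCons additive.add[OF assms(3)] assms)
qed

text \<open>Evaluation by \<open>G\<close> and \<open>g\<close> turns \<open>lam1\<close> into
  \<open>G\<close> and \<open>del1 s\<close> into \<open>D\<close>, because \<open>g\<close> carries
  \<partial> to \<open>D\<close> and \<open>D\<close> commutes with \<open>G\<close>. So each Horner
  step with -\<lambda> - \<partial> becomes one with \<open>- G - D\<close>.\<close>

lemma poly_subst_at1:
  fixes G D :: "'b::ab_group_add \<Rightarrow> 'b" and g :: "'a::ab_group_add \<Rightarrow> 'b"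
  assumes "additive G" "additive g" "additive D" "additive (s [:0, 1:])"
    and "\<And>x. D (G x) = G (D x)" "\<And>x. g (s [:0, 1:] x) = D (g x)"
  shows "poly_subst G g (at1 (- lam1 - del1 s) p) = poly_subst (- G - D) g p"
proof (induction p)
  case 0
  then show ?case by (simp add: at1_def)
next
  case (pCons a p)
  let ?K = "- lam1 - del1 s"
  have K: "additive ?K"
    unfolding del1_def by (intro additive_operators additive_map_poly assms)
  have "poly_subst G g (?K q) = (- G - D) (poly_subst G g q)" for q
    using additive_poly_subst[OF assms(1,2)]
    by (simp add: additive.diff additive.minus lam1_def del1_def poly_subst_pCons additive.zero
        poly_subst_map_poly[where D = D] assms)
  then have "poly_subst G g (at1 ?K (pCons a p)) =
      g a + (- G - D) (poly_subst G g (at1 ?K p))"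
    using additive_poly_subst[OF assms(1,2)]
    by (simp add: at1_def poly_subst_pCons[OF K additive_const_poly] additive.add)
  also have "\<dots> = poly_subst (- G - D) g (pCons a p)"
    by (simp only: pCons poly_subst_pCons additive_operators assms)
  finally show ?case .
qed

lemma at1_lam1: "at1 lam1 p = p"
  for p :: "'a::ab_group_add poly"
  unfolding at1_def
  by (induction p) (simp_all add: poly_subst_pCons additive_operators, simp add: lam1_def)

section \<open>The substitution of -\<lambda> - \<partial> over a module, before any product is
  given\<close>

locale poly_module = module scale
  for scale :: "complex poly \<Rightarrow> 'a::ab_group_add \<Rightarrow> 'a"
begin

lemma additive_scale: "additive (scale p)"
  by (simp add: additive_def scale_right_distrib)

lemma additive_del1: "additive (del1 scale)"
  unfolding del1_def by (intro additive_map_poly additive_scale)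

lemma additive_del2: "additive (del2 scale)"
  unfolding del2_def by (intro additive_map_poly additive_scale)

lemma coeff_pscale: "coeff (pscale scale c p) k = scale [:c:] (coeff p k)"
  by (simp add: pscale_def coeff_map_poly cscale_def)

lemma scale_const_add: "scale [:c + d:] x = scale [:c:] x + scale [:d:] x"
  by (simp flip: scale_left_distrib)

text \<open>\<open>Vector_Spaces.linear\<close> includes that source and target are vector spaces,
  so this fact and the next are required wherever a linear map is constructed.\<close>

lemma vector_space_cscale: "vector_space (cscale scale)"
  by unfold_locales
    (simp_all add: cscale_def scale_right_distrib scale_const_add mult.commute flip: one_pCons)

lemma vector_space_pscale: "vector_space (pscale scale)"
  by unfold_locales
    (simp_all add: poly_eq_iff coeff_pscale scale_right_distrib scale_const_add mult.commute
      flip: one_pCons)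

lemma additive_pscale: "additive (pscale scale c)"
  by (simp add: additive_def poly_eq_iff coeff_pscale scale_right_distrib)

lemma del1_lam1: "del1 scale (lam1 p) = lam1 (del1 scale p)"
  by (simp add: del1_def lam1_def map_poly_pCons)

lemma del2_lam2: "del2 scale (lam2 p) = lam2 (del2 scale p)"
  by (simp add: del2_def lam2_def map_poly_pCons)

lemma del2_mu2: "del2 scale (mu2 p) = mu2 (del2 scale p)"
  by (simp add: poly_eq_iff del2_def mu2_def coeff_map_poly coeff_pCons split: nat.splits)

lemma pscale_lam1: "pscale scale c (lam1 p) = lam1 (pscale scale c p)"
  by (simp add: poly_eq_iff coeff_pscale lam1_def coeff_pCons split: nat.splits)

lemma pscale_del1: "pscale scale c (del1 scale p) = del1 scale (pscale scale c p)"
  by (simp add: poly_eq_iff coeff_pscale del1_def coeff_map_poly mult.commute)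

abbreviation "K \<equiv> - lam1 - del1 scale"

lemma additive_K: "additive K"
  by (intro additive_operators additive_del1)

lemma additive_at1_K: "additive (at1 K)"
  unfolding at1_def by (intro additive_poly_subst additive_K additive_operators)

lemma at1_K_lam1: "at1 K (lam1 p) = K (at1 K p)"
  using poly_subst_pCons[OF additive_K additive_const_poly, of 0 p] by (simp add: at1_def lam1_def)

lemma at1_K_del1: "at1 K (del1 scale p) = del1 scale (at1 K p)"
proof -
  have "poly_subst K (\<lambda>x. [:x:]) (map_poly (scale [:0, 1:]) p) =
      del1 scale (poly_subst K (\<lambda>x. [:x:]) p)"
    by (rule poly_subst_map_poly[OF additive_K additive_const_poly additive_del1 additive_scale])
      (simp_all add: del1_lam1 additive.diff[OF additive_del1] additive.minus[OF additive_del1],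
       simp add: del1_def map_poly_pCons)
  then show ?thesis unfolding at1_def del1_def .
qed

lemma at1_K_pscale: "at1 K (pscale scale c p) = pscale scale c (at1 K p)"
proof -
  \<comment> \<open>Brings the coefficient map into the form \<open>scale p\<close>, to which
    \<open>additive_scale\<close> applies.\<close>
  have cscale: "cscale scale c = scale [:c:]" by (simp add: fun_eq_iff cscale_def)
  have "poly_subst K (\<lambda>x. [:x:]) (map_poly (cscale scale c) p) =
      pscale scale c (poly_subst K (\<lambda>x. [:x:]) p)"
    unfolding cscale
    by (rule poly_subst_map_poly[OF additive_K additive_const_poly additive_pscale additive_scale])
      (simp_all add: pscale_lam1 pscale_del1 additive.diff[OF additive_pscale]
        additive.minus[OF additive_pscale],
       simp add: pscale_def map_poly_pCons cscale)
  then show ?thesis unfolding at1_def pscale_def .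
qed

lemma at1_K_at1_K: "at1 K (at1 K p) = p"
proof -
  have "poly_subst K (\<lambda>x. [:x:]) (at1 K p) = poly_subst (- K - del1 scale) (\<lambda>x. [:x:]) p"
    by (rule poly_subst_at1[OF additive_K additive_const_poly additive_del1 additive_scale])
      (simp_all add: del1_lam1 additive.diff[OF additive_del1] additive.minus[OF additive_del1],
       simp add: del1_def map_poly_pCons)
  also have "- K - del1 scale = lam1" by (simp add: fun_eq_iff)
  finally show ?thesis using at1_lam1[of p] by (simp only: at1_def)
qed

text \<open>\<open>- G - del2 scale\<close> takes the role of \<open>G\<close> in
  \<open>poly_subst_at1\<close>, and sending \<open>G\<close> to \<open>- G - del2 scale\<close> is
  an involution.\<close>

lemma at2_at1_K:
  assumes "additive G" "\<And>x. del2 scale (G x) = G (del2 scale x)"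
  shows "at2 (- G - del2 scale) (at1 K p) = at2 G p"
proof -
  have "at2 (- G - del2 scale) (at1 K p) = at2 (- (- G - del2 scale) - del2 scale) p"
    unfolding at2_def
    by (rule poly_subst_at1)
      (simp_all add: assms additive_operators additive_del2 additive_scale
        additive.diff[OF additive_del2] additive.minus[OF additive_del2],
       simp add: del2_def map_poly_pCons)
  also have "- (- G - del2 scale) - del2 scale = G" by (simp add: fun_eq_iff)
  finally show ?thesis .
qed

lemma at2_at1_K_lam2: "at2 (- lam2 - del2 scale) (at1 K p) = at2 lam2 p"
  by (rule at2_at1_K) (simp_all add: additive_operators del2_lam2)

lemma at2_at1_K_lam2_mu2:
  "at2 (- lam2 - mu2 - del2 scale) (at1 K p) = at2 (lam2 + mu2) p"
proof -
  have "- lam2 - mu2 - del2 scale = - (lam2 + mu2) - del2 scale" by (simp add: fun_eq_iff)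
  then show ?thesis
    using at2_at1_K[of "lam2 + mu2"]
    by (simp add: additive_operators del2_lam2 del2_mu2 additive.add[OF additive_del2])
qed

end

text \<open>Constants and the indeterminate generate the polynomial ring, and the conformal axioms
  speak about exactly these two kinds of scalars.\<close>

lemma module_hom_complex_polyI:
  fixes s1 :: "complex poly \<Rightarrow> 'a::ab_group_add \<Rightarrow> 'a" and s2 :: "complex poly \<Rightarrow> 'b::ab_group_add \<Rightarrow> 'b"
  assumes "module s1" "module s2" "additive f"
    and "\<And>c x. f (s1 [:c:] x) = s2 [:c:] (f x)"
    and "\<And>x. f (s1 [:0, 1:] x) = s2 [:0, 1:] (f x)"
  shows "module_hom s1 s2 f"
proof -
  interpret m1: module s1 by fact
  interpret m2: module s2 by fact
  interpret additive f by fact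
  have pc: "pCons c p = [:c:] + [:0, 1:] * p" for c and p :: "complex poly" by simp
  have "f (s1 p x) = s2 p (f x)" for p x
  proof (induction p)
    case 0
    then show ?case by (simp add: zero)
  next
    case (pCons c p)
    then show ?case
      unfolding pc[of c p] m1.scale_left_distrib m2.scale_left_distrib
        m1.scale_scale[symmetric] m2.scale_scale[symmetric]
      by (simp only: add assms)
  qed
  then show ?thesis by unfold_locales (simp_all add: add)
qed


subsection \<open>The bimodule of a dendriform conformal algebra\<close>

context conformal_product
begin

lemma additive_left: "additive (\<lambda>a. prd a b)"
proof
  interpret Vector_Spaces.linear "cscale scale" "pscale scale" "\<lambda>a. prd a b" by (rule linear_left)
  show "prd (a + a') b = prd a b + prd a' b" for a a' by (rule add)
qed

lemma additive_right: "additive (prd a)"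
proof
  interpret Vector_Spaces.linear "cscale scale" "pscale scale" "prd a" by (rule linear_right)
  show "prd a (b + b') = prd a b + prd a b'" for b b' by (rule add)
qed

lemma scale_const_left: "prd (scale [:c:] a) b = pscale scale c (prd a b)"
proof -
  interpret Vector_Spaces.linear "cscale scale" "pscale scale" "\<lambda>a. prd a b" by (rule linear_left)
  show ?thesis using scale[of c a] by (simp add: cscale_def)
qed

lemma scale_const_right: "prd a (scale [:c:] b) = pscale scale c (prd a b)"
proof -
  interpret Vector_Spaces.linear "cscale scale" "pscale scale" "prd a" by (rule linear_right)
  show ?thesis using scale[of c b] by (simp add: cscale_def)
qed

end

lemma additive_at2:
  fixes F :: "'a::ab_group_add poly poly \<Rightarrow> 'a poly poly" and q :: "'b::ab_group_add \<Rightarrow> 'a poly"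
  assumes "additive F" "additive q"
  shows "additive (\<lambda>x. at2 F (q x))"
  unfolding at2_def using additive_poly_subst[OF assms(1) additive_const_poly2] assms(2)
  by (simp add: additive_def)

section \<open>Associativity of the sum product, and the two actions\<close>

context dendriform_conformal_algebra
begin

sublocale poly_module scale ..

lemma assoc_star: "assoc_conformal_algebra scale (star_product lprd rprd)"
proof (intro assoc_conformal_algebra.intro conformal_product.intro conformal_product_axioms.intro
    assoc_conformal_algebra_axioms.intro lprd.module_axioms)
  let ?s = "star_product lprd rprd"
  note adds = additive.add[OF lprd.additive_left] additive.add[OF rprd.additive_left]
    additive.add[OF lprd.additive_right] additive.add[OF rprd.additive_right]
    additive.add[OF additive_lam1] additive.add[OF additive_del1] additive.add[OF additive_pscale]
  interpret C: vector_space "cscale scale" by (rule vector_space_cscale)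
  interpret P: vector_space "pscale scale" by (rule vector_space_pscale)
  show "Vector_Spaces.linear (cscale scale) (pscale scale) (\<lambda>a. ?s a b)" for b
    by unfold_locales
      (simp_all add: star_product_def adds cscale_def lprd.scale_const_left rprd.scale_const_left)
  show "Vector_Spaces.linear (cscale scale) (pscale scale) (?s a)" for a
    by unfold_locales
      (simp_all add: star_product_def adds cscale_def lprd.scale_const_right rprd.scale_const_right)
  show "?s (scale [:0, 1:] a) b = (- lam1) (?s a b)" for a b
    by (simp add: star_product_def lprd.del_left rprd.del_left adds)
  show "?s a (scale [:0, 1:] b) = (del1 scale + lam1) (?s a b)" for a b
    by (simp add: star_product_def lprd.del_right rprd.del_right adds)
  fix a b c
  let ?F = "lam2 + mu2 :: 'a poly poly \<Rightarrow> _"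
  have F: "additive ?F" by (intro additive_operators)
  have at2_add: "additive (at2 G)" if "additive G" for G :: "'a poly poly \<Rightarrow> _"
    unfolding at2_def by (intro additive_poly_subst additive_operators that)
  have left_l: "additive (\<lambda>x. at2 ?F (lprd x c))" and left_r: "additive (\<lambda>x. at2 ?F (rprd x c))"
    by (intro additive_at2 F lprd.additive_left rprd.additive_left)+
  have right_l: "additive (\<lambda>y. at2 lam2 (lprd a y))" and right_r: "additive (\<lambda>y. at2 lam2 (rprd a y))"
    by (intro additive_at2 additive_lam2 lprd.additive_right rprd.additive_right)+
  have sl: "poly_subst lam2 g (p + q) = poly_subst lam2 g p + poly_subst lam2 g q"
    if "additive g" for g :: "'a \<Rightarrow> 'a poly poly" and p q
    by (intro additive.add additive_poly_subst additive_operators that)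
  have sm: "poly_subst mu2 g (p + q) = poly_subst mu2 g p + poly_subst mu2 g q"
    if "additive g" for g :: "'a \<Rightarrow> 'a poly poly" and p q
    by (intro additive.add additive_poly_subst additive_operators that)
  \<comment> \<open>The inner product is split only under an outer \<open>lprd\<close>:
    \<open>prec_prec\<close> and \<open>succ_prec\<close> take the two halves separately, whereas
    \<open>succ_succ\<close> needs the whole star product.\<close>
  have "poly_subst lam2 (\<lambda>x. at2 ?F (?s x c)) (?s a b) =
      poly_subst lam2 (\<lambda>x. at2 ?F (lprd x c)) (lprd a b) +
      poly_subst lam2 (\<lambda>x. at2 ?F (lprd x c)) (rprd a b) +
      poly_subst lam2 (\<lambda>x. at2 ?F (rprd x c)) (?s a b)"
    unfolding star_product_def additive.add[OF at2_add[OF F]]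
      poly_subst_fun_plus[OF additive_lam2 left_l left_r]
    by (simp only: sl left_l left_r)
  \<comment> \<open>\<open>prec_prec\<close> and \<open>succ_prec\<close> rewrite the first two
    summands on the left, \<open>succ_succ\<close> the last one on the right.\<close>
  also have "\<dots> = poly_subst mu2 (\<lambda>y. at2 lam2 (lprd a y)) (?s b c) +
      poly_subst mu2 (\<lambda>y. at2 lam2 (rprd a y)) (lprd b c) +
      poly_subst mu2 (\<lambda>y. at2 lam2 (rprd a y)) (rprd b c)"
    by (simp only: prec_prec succ_prec succ_succ)
  also have "\<dots> = poly_subst mu2 (\<lambda>y. at2 lam2 (?s a y)) (?s b c)"
    unfolding star_product_def additive.add[OF at2_add[OF additive_lam2]]
      poly_subst_fun_plus[OF additive_mu2 right_l right_r]
    by (simp only: sm right_l right_r add.assoc)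
  finally show "poly_subst lam2 (\<lambda>x. at2 ?F (?s x c)) (?s a b) =
      poly_subst mu2 (\<lambda>y. at2 lam2 (?s a y)) (?s b c)" .
qed

lemma at1_R_prec: "at1 K (R_prec scale lprd a b) = lprd b a"
  by (simp only: R_prec_def at1_K_at1_K)

lemma module_hom_L_succ: "module_hom scale (cend_scale scale) (L_succ rprd)"
proof (rule module_hom_complex_polyI)
  show "module (cend_scale scale)" by (intro module_cend_scale lprd.module_axioms)
  show "additive (L_succ rprd)"
    using rprd.additive_left by (simp add: additive_def L_succ_def fun_eq_iff)
qed (simp_all add: lprd.module_axioms cend_scale_const cend_scale_del fun_eq_iff L_succ_def
    rprd.scale_const_left rprd.del_left)

text \<open>The acting element is the second argument of \<open>lprd\<close>, where \<partial> comes
  out as \<partial> + \<lambda>. The substitution makes this \<partial> + (-\<lambda> - \<partial>)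
  = -\<lambda>, as the module structure on \<open>Cend\<close> demands.\<close>

lemma module_hom_R_prec: "module_hom scale (cend_scale scale) (R_prec scale lprd)"
proof (rule module_hom_complex_polyI)
  show "module (cend_scale scale)" by (intro module_cend_scale lprd.module_axioms)
  show "additive (R_prec scale lprd)"
    using lprd.additive_right additive_at1_K by (simp add: additive_def R_prec_def fun_eq_iff)
  show "R_prec scale lprd (scale [:0, 1:] a) = cend_scale scale [:0, 1:] (R_prec scale lprd a)" for a
    by (simp add: cend_scale_del lprd.module_axioms fun_eq_iff R_prec_def lprd.del_right
        additive.add[OF additive_at1_K] at1_K_lam1 at1_K_del1)
qed (simp_all add: lprd.module_axioms cend_scale_const fun_eq_iff R_prec_def lprd.scale_const_right at1_K_pscale)

text \<open>Dually, \<partial> on the first argument of \<open>lprd\<close> comes out as -\<lambda>,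
  which the substitution makes \<lambda> + \<partial>.\<close>

lemma R_prec_Cend: "R_prec scale lprd a \<in> Cend scale"
proof -
  interpret C: vector_space "cscale scale" by (rule vector_space_cscale)
  interpret P: vector_space "pscale scale" by (rule vector_space_pscale)
  have "Vector_Spaces.linear (cscale scale) (pscale scale) (R_prec scale lprd a)"
    by unfold_locales
      (simp_all add: R_prec_def cscale_def lprd.scale_const_left at1_K_pscale
        additive.add[OF lprd.additive_left] additive.add[OF additive_at1_K])
  moreover have "R_prec scale lprd a (scale [:0, 1:] v) = (del1 scale + lam1) (R_prec scale lprd a v)" for v
    by (simp add: R_prec_def lprd.del_left additive.minus[OF additive_at1_K] at1_K_lam1)
  ultimately show ?thesis by (simp add: Cend_def)
qed

lemma L_succ_Cend: "L_succ rprd a \<in> Cend scale"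
  using rprd.linear_right rprd.del_right by (simp add: Cend_def L_succ_def[abs_def])

lemma conformal_bimodule_L_R:
  "conformal_bimodule scale (star_product lprd rprd) scale (L_succ rprd) (R_prec scale lprd)"
proof -
  interpret star: assoc_conformal_algebra scale "star_product lprd rprd" by (rule assoc_star)
  interpret l: module_hom scale "cend_scale scale" "L_succ rprd" by (rule module_hom_L_succ)
  interpret r: module_hom scale "cend_scale scale" "R_prec scale lprd" by (rule module_hom_R_prec)
  show ?thesis
    \<comment> \<open>\<open>l_prd\<close> becomes \<open>succ_succ\<close>, \<open>r_prd\<close>
      becomes \<open>prec_prec\<close> with the module element leftmost, and \<open>l_r\<close>
      becomes \<open>succ_prec\<close> with it in the middle.\<close>
    by unfold_locales
      (simp_all only: L_succ_Cend R_prec_Cend at1_R_prec R_prec_def at1_K_at1_K at2_at1_K_lam2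
        at2_at1_K_lam2_mu2 L_succ_def succ_succ prec_prec succ_prec)
qed

end

theorem proposition6p12:
  fixes scale :: "complex poly \<Rightarrow> 'a::ab_group_add \<Rightarrow> 'a"
    and lprd rprd :: "'a \<Rightarrow> 'a \<Rightarrow> 'a poly"
  assumes "dendriform_conformal_algebra scale lprd rprd"
  shows "conformal_bimodule scale (star_product lprd rprd) scale
           (L_succ rprd) (R_prec scale lprd) \<and>
         O_operator scale (star_product lprd rprd) scale
           (L_succ rprd) (R_prec scale lprd) id"
proof -
  interpret dendriform_conformal_algebra scale lprd rprd by fact
  interpret bim: conformal_bimodule scale "star_product lprd rprd" scale
    "L_succ rprd" "R_prec scale lprd"
    by (rule conformal_bimodule_L_R)
  have "O_operator scale (star_product lprd rprd) scale (L_succ rprd) (R_prec scale lprd) id"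
    \<comment> \<open>For \<open>id\<close> the identity has the \<open>rprd\<close> term first and
      the \<open>lprd\<close> term second, hence the commutation.\<close>
    by unfold_locales (simp_all add: at1_R_prec L_succ_def star_product_def add.commute
        del: minus_apply uminus_apply)
  then show ?thesis using conformal_bimodule_L_R by blast
qed

end
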